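(* Let $p,q,d$ be positive integers. Let $\phi_i:\{0,1\}^p\to\{0,1\}$, $i\in[q]$, be Boolean functions such that (i) $\displaystyle \min_{y\in\{0,1\}^p}\sum_{i=1}^q\phi_i(y)=1$, and (ii) for every $I\subseteq[q]$ with $I\neq[q]$ there exists $y_I\in\{0,1\}^p$ such that $\displaystyle\sum_{i\in I}\phi_i(y_I)=0$. Let $P_i\subseteq[d]$, $i\in[q]$, be subsets covering $[d]$, i.e. $\bigcup_{i\in[q]}P_i=[d]$. Then for all $x=(x_1,\dots,x_d)\in\{0,1\}^d$, $$\prod_{j=1}^d x_j=\min_{y\in\{0,1\}^p}\ \sum_{i=1}^q\phi_i(y)\prod_{j\in P_i}x_j .$$
   Context: For a positive integer $m$, $[m]=\{1,2,\dots,m\}$. The values $0,1$ are treated as real numbers in sums and products. Empty sums equal $0$ and empty products equal $1$. *)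

theory Defs
  imports Complex_Main "HOL-Library.FuncSet"
begin

(* The n-cube {0,1}^n, with coordinates indexed by 1, ..., n and entries taken as real numbers.
   Points are extensional functions, so cube n has exactly 2^n elements; in particular it is
   finite and nonempty, and Min over an image of it is a genuine minimum. *)
definition cube :: "nat \<Rightarrow> (nat \<Rightarrow> real) set" where
  "cube n = {1..n} \<rightarrow>\<^sub>E {0, 1}"

end

(* If some x j is 0, the indices i whose product over P i equals 1 form a proper subset I of
   {1..q}, because some P i contains j; the point y_I of the second hypothesis on the functions
   then makes the nonnegative objective vanish. *)
theory Submission
  imports Defs
begin

lemma finite_cube [simp]: "finite (cube n)"
  unfolding cube_def by (intro finite_PiE) auto

lemma cubeD: "x \<in> cube n \<Longrightarrow> j \<in> {1..n} \<Longrightarrow> x j = 0 \<or> x j = 1"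
  using PiE_mem[of x "{1..n}" "\<lambda>_. {0, 1}" j] by (simp add: cube_def)

text \<open>A factor 0 annihilates a finite product. Over an infinite index set \<open>prod\<close>
  takes the default value 1, so the dichotomy survives without a finiteness assumption.\<close>

lemma prod_zero_one:
  fixes f :: "'a \<Rightarrow> 'b :: comm_semiring_1"
  assumes "\<And>j. j \<in> A \<Longrightarrow> f j = 0 \<or> f j = 1"
  shows "prod f A = 0 \<or> prod f A = 1"
proof (cases "\<forall>j\<in>A. f j = 1")
  case True
  then show ?thesis
    by simp
next
  case False
  then obtain j where "j \<in> A" "f j = 0"
    using assms by blast
  then show ?thesis
    by (cases "finite A") (auto intro: prod_zero)
qed

theorem theorem1:
  fixes p q d :: nat
    and \<phi> :: "nat \<Rightarrow> (nat \<Rightarrow> real) \<Rightarrow> real"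
    and P :: "nat \<Rightarrow> nat set"
  assumes "p > 0" and "q > 0" and "d > 0"
    and "\<And>i. i \<in> {1..q} \<Longrightarrow> \<phi> i \<in> cube p \<rightarrow> {0, 1}"
    and "Min ((\<lambda>y. \<Sum>i\<in>{1..q}. \<phi> i y) ` cube p) = 1"
    and "\<And>I. I \<subseteq> {1..q} \<Longrightarrow> I \<noteq> {1..q} \<Longrightarrow> \<exists>y\<in>cube p. (\<Sum>i\<in>I. \<phi> i y) = 0"
    and "\<And>i. i \<in> {1..q} \<Longrightarrow> P i \<subseteq> {1..d}"
    and "(\<Union>i\<in>{1..q}. P i) = {1..d}"
  shows "\<forall>x\<in>cube d. (\<Prod>j\<in>{1..d}. x j) =
           Min ((\<lambda>y. \<Sum>i\<in>{1..q}. \<phi> i y * (\<Prod>j\<in>P i. x j)) ` cube p)"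
proof
  fix x assume x: "x \<in> cube d"
  \<comment> \<open>For fixed \<open>x\<close> these products do not depend on \<open>y\<close>:
    they are 0/1 weights that select which \<phi> i enter the objective.\<close>
  define w where "w i = (\<Prod>j\<in>P i. x j)" for i
  have w01: "w i = 0 \<or> w i = 1" if "i \<in> {1..q}" for i
    unfolding w_def using assms(7)[OF that] cubeD[OF x] by (intro prod_zero_one) blast
  have "(\<Prod>j\<in>{1..d}. x j) = Min ((\<lambda>y. \<Sum>i\<in>{1..q}. \<phi> i y * w i) ` cube p)"
  proof (cases "\<forall>j\<in>{1..d}. x j = 1")
    case True
    then have "w i = 1" if "i \<in> {1..q}" for i
      unfolding w_def using assms(7)[OF that] by (intro prod.neutral) blast
    \<comment> \<open>All weights are 1, so the objective is the unweighted sum, whose minimum is 1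
      by \<open>assms(5)\<close>.\<close>
    then show ?thesis
      using True assms(5) by simp
  next
    case False
    then obtain j where j: "j \<in> {1..d}" "x j = 0"
      using cubeD[OF x] by blast
    then obtain k where k: "k \<in> {1..q}" "j \<in> P k"
      using assms(8) by blast
    \<comment> \<open>Finiteness lets the factor \<open>x j = 0\<close> force
      \<open>w k = 0\<close>, in view of the default value of \<open>prod\<close> on infinite
      sets.\<close>
    have "finite (P k)"
      using assms(7)[OF k(1)] finite_subset by blast
    then have wk: "w k = 0"
      unfolding w_def using j k by (intro prod_zero) auto
    define I where "I = {i \<in> {1..q}. w i = 1}"
    have "I \<subseteq> {1..q}" and "k \<notin> I"
      using wk unfolding I_def by auto
    then have "I \<subseteq> {1..q}" "I \<noteq> {1..q}"
      using k(1) by blast+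
    then obtain y where y: "y \<in> cube p" "(\<Sum>i\<in>I. \<phi> i y) = 0"
      using assms(6) by blast
    have "w i = 0" if "i \<in> {1..q} - I" for i
      using w01[of i] that by (auto simp: I_def)
    \<comment> \<open>Indices outside \<open>I\<close> have weight 0 and drop out; those in
      \<open>I\<close> have weight 1.\<close>
    then have "(\<Sum>i\<in>{1..q}. \<phi> i y * w i) = (\<Sum>i\<in>I. \<phi> i y)"
      by (intro sum.mono_neutral_cong_right) (auto simp: I_def)
    then have attained: "(\<Sum>i\<in>{1..q}. \<phi> i y * w i) = 0"
      using y by simp
    have "0 \<le> (\<Sum>i\<in>{1..q}. \<phi> i z * w i)" if "z \<in> cube p" for z
    proof (intro sum_nonneg mult_nonneg_nonneg)
      fix i assume i: "i \<in> {1..q}"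
      show "0 \<le> \<phi> i z"
        using funcset_mem[OF assms(4)[OF i] that] by auto
      show "0 \<le> w i"
        using w01[OF i] by auto
    qed
    \<comment> \<open>The value 0 is a lower bound by nonnegativity, and \<open>attained\<close>,
      reversed, exhibits 0 as the image of \<open>y\<close>.\<close>
    then have "Min ((\<lambda>y. \<Sum>i\<in>{1..q}. \<phi> i y * w i) ` cube p) = 0"
      by (intro Min_eqI) (use y(1) attained[symmetric] in \<open>blast intro: finite_imageI finite_cube\<close>)+
    moreover have "(\<Prod>j\<in>{1..d}. x j) = 0"
      using j by (intro prod_zero) auto
    ultimately show ?thesis
      by simp
  qed
  then show "(\<Prod>j\<in>{1..d}. x j) =
      Min ((\<lambda>y. \<Sum>i\<in>{1..q}. \<phi> i y * (\<Prod>j\<in>P i. x j)) ` cube p)"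
    by (simp only: w_def)
qed

end
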